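(* Consider the noiseless pooled data problem with fixed $d$ and fixed $\pi$, under the approximate recovery criterion with maximum Hamming distance $q_{\max}\in\{0,\dots,p\}$. For any (possibly random) non-adaptive test matrix and any decoder, in order to achieve $P_e(q_{\max})\not\to1$ as $p\to\infty$, it is necessary that $$n\ \ge\ \frac{1}{\log p}\left(\max_{r\in\{1,\dots,d-1\}}\frac{2\Big(pH(\pi)-pH(\pi^{(r)})-\log\sum_{j=0}^{q_{\max}}\binom pj(d-1)^j\Big)}{d-r}\right)(1-\eta)$$ for arbitrarily small $\eta>0$.
   Context: Setup: $\pi=(\pi_1,\dots,\pi_d)$ is a probability vector not depending on $p$ (with $p\pi_t$ integers). $\mathcal B(\pi)$ is the set of $b\in[d]^p$ with exactly $p\pi_t$ entries equal to $t$; $\beta$ is uniform on $\mathcal B(\pi)$. The test matrix $\mathbf X\in\{0,1\}^{n\times p}$ with rows $X^{(i)}$ is chosen non-adaptively, independent of $\beta$. Noiseless model: $Y^{(i)}=(N_1(\beta,X^{(i)}),\dots,N_d(\beta,X^{(i)}))$ with $N_t(\beta,X)=\sum_j\mathbf 1\{\beta_j=t,X_j=1\}$. A decoder outputs $\hat\beta\in[d]^p$ from $(\mathbf X,\mathbf Y)$. Approximate recovery error probability: $P_e(q_{\max})=\mathbb P\big[\sum_{j=1}^p\mathbf 1\{\hat\beta_j\neq\beta_j\}>q_{\max}\big]$. Logs natural, entropy in nats. For $r\in\{1,\dots,d-1\}$, $\pi^{(r)}$ is the length-$r$ probability vector whose first entry is the sum of the largest $d-r+1$ entries of $\pi$ and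 whose remaining $r-1$ entries are the remaining entries of $\pi$.
   Formalization: The formal theorem also assumes that the lower bound on n (without the factor 1−η) tends to infinity; otherwise the claim fails, e.g. d=2, π=(1/2,1/2), q_max=p/2, n=0, where always guessing one label gives P_e=0 although the bound is positive. *)

theory Defs
  imports "HOL-Probability.Probability"
begin

text \<open>Categories are labelled 1..d, item positions 0..p-1, tests 0..n-1.
  A test matrix is a function X with X i j = True iff item j is in test i.
  A probability vector pi of length d is a function nat => real on {1..d}.\<close>

type_synonym test_matrix = "nat \<Rightarrow> nat \<Rightarrow> bool"
type_synonym outcomes = "nat \<Rightarrow> nat \<Rightarrow> nat"
type_synonym decoder = "test_matrix \<Rightarrow> outcomes \<Rightarrow> (nat \<Rightarrow> nat)"

definition Bset :: "nat \<Rightarrow> (nat \<Rightarrow> real) \<Rightarrow> nat \<Rightarrow> (nat \<Rightarrow> nat) set" where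
  "Bset d \<pi> p = {b \<in> {0..<p} \<rightarrow>\<^sub>E {1..d}.
      \<forall>t\<in>{1..d}. real (card {j\<in>{0..<p}. b j = t}) = real p * \<pi> t}"

definition Ncount :: "nat \<Rightarrow> (nat \<Rightarrow> nat) \<Rightarrow> (nat \<Rightarrow> bool) \<Rightarrow> nat \<Rightarrow> nat" where
  "Ncount p b x t = card {j\<in>{0..<p}. b j = t \<and> x j}"

definition outcome :: "nat \<Rightarrow> nat \<Rightarrow> test_matrix \<Rightarrow> (nat \<Rightarrow> nat) \<Rightarrow> outcomes" where
  "outcome n p X b = (\<lambda>i t. if i < n then Ncount p b (X i) t else 0)"

definition Perr :: "nat \<Rightarrow> (nat \<Rightarrow> real) \<Rightarrow> nat \<Rightarrow> nat \<Rightarrow> nat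
                     \<Rightarrow> (test_matrix \<times> decoder) pmf \<Rightarrow> real" where
  "Perr d \<pi> p n qmax D =
     measure_pmf.prob (pair_pmf (pmf_of_set (Bset d \<pi> p)) D)
       {(b, (X, dec)). card {j\<in>{0..<p}. dec X (outcome n p X b) j \<noteq> b j} > qmax}"

text \<open>Entropy (nats) of a finite probability vector given as a list (0 ln 0 = 0).\<close>
definition ent :: "real list \<Rightarrow> real" where
  "ent xs = - sum_list (map (\<lambda>x. x * ln x) xs)"

definition pvec :: "nat \<Rightarrow> (nat \<Rightarrow> real) \<Rightarrow> real list" where
  "pvec d \<pi> = map \<pi> [1..<d+1]"

definition pi_r :: "nat \<Rightarrow> (nat \<Rightarrow> real) \<Rightarrow> nat \<Rightarrow> real list" where
  "pi_r d \<pi> r = (let L = rev (sort (pvec d \<pi>))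
                  in sum_list (take (d - r + 1) L) # drop (d - r + 1) L)"

definition nbound :: "nat \<Rightarrow> (nat \<Rightarrow> real) \<Rightarrow> nat \<Rightarrow> nat \<Rightarrow> real" where
  "nbound d \<pi> p qmax =
     (1 / ln (real p)) *
     Max ((\<lambda>r. 2 * (real p * ent (pvec d \<pi>) - real p * ent (pi_r d \<pi> r)
                     - ln (\<Sum>j\<le>qmax. real (p choose j) * (real d - 1) ^ j))
                / real (d - r)) ` {1..d-1})"

end

theory Submission
  imports Defs "HOL-Combinatorics.Multiset_Permutations" "HOL-Real_Asymp.Real_Asymp"
begin

text \<open>Fix the test matrix, the decoder and \<open>r\<close>, and reveal to the decoder which items carry a
  label from the set \<open>S\<close> of the \<open>d - r + 1\<close> most likely labels, together with the labels of all
  other items. Up to a factor polynomial in \<open>p\<close>, the uniform law on \<open>Bset\<close> is dominated by the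
  i.i.d. law with marginal \<open>\<pi>\<close>, so by a Chernoff bound all counts of all tests lie within
  \<open>sqrt p * ln p\<close> of their means, except with vanishing probability. Given the revealed information
  each test then has \<open>d - r\<close> free counts, each with only about \<open>sqrt p * ln p\<close> possible values: this
  square root is the factor 2 in the bound. Hence the number of successfully decoded vectors is at
  most the number of merged vectors (at most \<open>exp (p H(pi_r))\<close>), times the number of typical outcomes,
  times the size of a Hamming ball of radius \<open>q\<close>, to be compared with
  \<open>exp (p H(\<pi>))\<close>, the size of \<open>Bset\<close> up to a polynomial factor.\<close>

section \<open>Estimates of log factorials\<close>

text \<open>The single term \<open>n ^ n / fact n\<close> of the exponential series at
  \<open>n\<close> is at most \<open>exp n\<close>.\<close>

lemma ln_fact_ge: "real n * ln (real n) - real n \<le> ln (fact n :: real)"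
proof (cases "n = 0")
  case False
  have s: "(\<lambda>k. real n ^ k /\<^sub>R fact k) sums exp (real n)"
    by (rule exp_converges)
  have "(\<Sum>k\<in>{n}. real n ^ k /\<^sub>R fact k) \<le> exp (real n)"
    unfolding sums_unique[OF s]
    by (intro sum_le_suminf sums_summable[OF s]) auto
  hence "real n ^ n \<le> exp (real n) * fact n"
    by (simp add: field_simps)
  hence "ln (real n ^ n) \<le> ln (exp (real n) * fact n)"
    using False by (subst ln_le_cancel_iff) auto
  thus ?thesis
    using False by (simp add: ln_mult ln_realpow)
qed auto

text \<open>Induction from 1 upwards. With \<open>x\<close> the old argument, the step comes down to
  \<open>1 \<le> (x + 1) * (ln (x + 1) - ln x)\<close>, which is \<open>ln y \<le> y - 1\<close> at
  \<open>y = x / (x + 1)\<close>.\<close>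

lemma ln_fact_le:
  "ln (fact n :: real) \<le> real n * ln (real n) - real n + 1 + ln (real n + 1)"
proof (cases "n = 0")
  case False
  have "ln (fact (Suc m) :: real) \<le> real (Suc m) * ln (real (Suc m)) - real (Suc m) + 1 + ln (real (Suc m))" for m
  proof (induction m)
    case (Suc m)
    define x where "x = real (Suc m)"
    have x: "x \<ge> 1" by (simp add: x_def)
    have "ln (x / (x + 1)) \<le> x / (x + 1) - 1"
      using x by (intro ln_le_minus_one) auto
    hence "1 / (x + 1) \<le> ln (x + 1) - ln x"
      using x by (simp add: ln_div field_simps)
    hence "1 \<le> (x + 1) * (ln (x + 1) - ln x)"
      using x by (simp add: field_simps)
    moreover have "ln (fact (Suc (Suc m)) :: real) = ln (x + 1) + ln (fact (Suc m))"
      unfolding fact_Suc[of "Suc m"] x_def by (subst ln_mult) (simp_all add: add_ac del: fact_Suc)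
    moreover have "real (Suc (Suc m)) = x + 1" by (simp add: x_def)
    ultimately show ?case using Suc unfolding x_def[symmetric]
      by (simp add: distrib_right right_diff_distrib add.commute[of 1] del: fact_Suc)
  qed auto
  from this[of "n - 1"] False
  have "ln (fact n :: real) \<le> real n * ln (real n) - real n + 1 + ln (real n)" by simp
  moreover have "ln (real n) \<le> ln (real n + 1)" using False by simp
  ultimately show ?thesis by linarith
qed auto

section \<open>Sizes of type classes\<close>

text \<open>Multinomial coefficient: listing the values at \<open>0..<p\<close> identifies such
  functions with the orderings of the multiset \<open>M\<close> that holds \<open>m t\<close> copies
  of each \<open>t\<close>.\<close>

lemma card_functions_with_counts:
  fixes m :: "'a \<Rightarrow> nat"
  assumes T: "finite T" and m: "(\<Sum>t\<in>T. m t) = p"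
  shows "card {b \<in> {0..<p} \<rightarrow>\<^sub>E T. \<forall>t\<in>T. card {j\<in>{0..<p}. b j = t} = m t} * (\<Prod>t\<in>T. fact (m t)) = fact p"
    (is "card ?B * _ = _")
proof -
  define M where "M = (\<Sum>t\<in>T. replicate_mset (m t) t)"
  have cM: "count M t = (if t \<in> T then m t else 0)" for t
    using T by (simp add: M_def count_sum sum.delta if_distrib cong: if_cong)
  have sM: "size M = p"
    by (simp add: M_def m size_multiset_sum)
  have cnt: "count (mset (map b [0..<p])) t = card {j\<in>{0..<p}. b j = t}" for b and t :: 'a
  proof -
    have "count (mset (map b [0..<p])) t = length (filter (\<lambda>j. t = b j) [0..<p])"
      unfolding count_mset count_list_eq_length_filter filter_map by (simp add: o_def)
    also have "\<dots> = card (set (filter (\<lambda>j. t = b j) [0..<p]))"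
      by (rule distinct_card[symmetric]) simp
    also have "\<dots> = card {j\<in>{0..<p}. b j = t}"
      by (rule arg_cong[where f = card]) auto
    finally show ?thesis .
  qed
  have "bij_betw (\<lambda>b. map b [0..<p]) ?B (permutations_of_multiset M)"
  proof (rule bij_betw_byWitness[where f' = "\<lambda>xs j. if j < p then xs ! j else undefined"])
    show "\<forall>b\<in>?B. (\<lambda>j. if j < p then map b [0..<p] ! j else undefined) = b"
      by (auto simp: fun_eq_iff PiE_def extensional_def)
    show "\<forall>xs\<in>permutations_of_multiset M. map (\<lambda>j. if j < p then xs ! j else undefined) [0..<p] = xs"
      using sM by (auto intro!: nth_equalityI dest: permutations_of_multisetD simp: size_mset[symmetric] simp del: size_mset)
    show "(\<lambda>b. map b [0..<p]) ` ?B \<subseteq> permutations_of_multiset M"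
    proof safe
      fix b assume b: "b \<in> {0..<p} \<rightarrow>\<^sub>E T" "\<forall>t\<in>T. card {j \<in> {0..<p}. b j = t} = m t"
      have "count (mset (map b [0..<p])) t = count M t" for t
      proof (cases "t \<in> T")
        case False
        hence "{j\<in>{0..<p}. b j = t} = {}" using b(1) by auto
        thus ?thesis unfolding cnt cM using False by simp
      qed (use b in \<open>simp only: cnt cM if_True\<close>)
      thus "map b [0..<p] \<in> permutations_of_multiset M"
        by (intro permutations_of_multisetI multiset_eqI)
    qed
    show "(\<lambda>xs j. if j < p then xs ! j else undefined) ` permutations_of_multiset M \<subseteq> ?B"
    proof (intro image_subsetI CollectI conjI ballI)
      fix xs assume xs: "xs \<in> permutations_of_multiset M"
      let ?b = "\<lambda>j. if j < p then xs ! j else undefined"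
      from xs have xs: "mset xs = M" by (rule permutations_of_multisetD)
      hence len: "length xs = p" using sM by (metis size_mset)
      have mp: "map ?b [0..<p] = xs" using len by (auto intro!: nth_equalityI)
      have "set xs \<subseteq> T" using xs cM by (metis (full_types) count_eq_zero_iff set_mset_mset subsetI)
      thus "?b \<in> {0..<p} \<rightarrow>\<^sub>E T" using len by auto
      show "card {j \<in> {0..<p}. ?b j = t} = m t" if "t \<in> T" for t
        using cnt[of ?b t] unfolding mp xs cM using that by simp
    qed
  qed
  hence cB: "card ?B = card (permutations_of_multiset M)" by (rule bij_betw_same_card)
  \<comment> \<open>Labels with \<open>m t = 0\<close> do not occur in \<open>M\<close> and
    contribute the factor \<open>fact 0 = 1\<close>, so the products over \<open>set_mset M\<close>
    and over \<open>T\<close> agree.\<close>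
  have out: "m t = 0" if "t \<in> T - set_mset M" for t
    using that cM[of t] by (metis DiffE count_eq_zero_iff)
  have "set_mset M \<subseteq> T"
    using cM by (metis (full_types) count_eq_zero_iff subsetI)
  hence "(\<Prod>t\<in>set_mset M. fact (count M t)) = (\<Prod>t\<in>T. fact (m t) :: nat)"
    by (intro prod.mono_neutral_cong_left) (use T cM out in auto)
  thus ?thesis
    using card_permutations_of_multiset_aux[of M] sM cB by simp
qed

lemma prod_comp_eq_prod_power:
  fixes w :: "'b \<Rightarrow> 'c::comm_monoid_mult"
  assumes "finite A" "finite T" "f ` A \<subseteq> T"
  shows "(\<Prod>a\<in>A. w (f a)) = (\<Prod>t\<in>T. w t ^ card {a\<in>A. f a = t})"
proof -
  have "(\<Prod>a\<in>A. w (f a)) = (\<Prod>t\<in>T. \<Prod>a\<in>{a\<in>A. f a = t}. w (f a))"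
    by (rule prod.group[symmetric]) (use assms in auto)
  also have "\<dots> = (\<Prod>t\<in>T. w t ^ card {a\<in>A. f a = t})"
    by (intro prod.cong refl) simp
  finally show ?thesis .
qed

text \<open>The i.i.d. law with marginal \<open>w\<close> gives one and the same weight to all
  vectors of type \<open>w\<close>, because each factor \<open>w t\<close> occurs
  \<open>p * w t\<close> times. Cardinalities can thus be exchanged for weights, with the negative
  entropy of \<open>w\<close> in the exponent.\<close>

lemma prod_weights_of_type:
  fixes w :: "'a \<Rightarrow> real"
  assumes T: "finite T" and w: "\<And>t. t \<in> T \<Longrightarrow> w t \<ge> 0"
    and b: "b ` {0..<p} \<subseteq> T" "\<And>t. t \<in> T \<Longrightarrow> real (card {j\<in>{0..<p}. b j = t}) = real p * w t"
  shows "(\<Prod>j\<in>{0..<p}. w (b j)) = exp (real p * (\<Sum>t\<in>T. w t * ln (w t)))"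
proof -
  have "(\<Prod>j\<in>{0..<p}. w (b j)) = (\<Prod>t\<in>T. w t ^ card {j\<in>{0..<p}. b j = t})"
    by (rule prod_comp_eq_prod_power) (use T b in auto)
  also have "\<dots> = (\<Prod>t\<in>T. exp (real p * (w t * ln (w t))))"
  proof (intro prod.cong refl)
    fix t assume t: "t \<in> T"
    show "w t ^ card {j\<in>{0..<p}. b j = t} = exp (real p * (w t * ln (w t)))"
    proof (cases "w t = 0")
      \<comment> \<open>A label of weight 0 never occurs, and \<open>0 ^ 0 = 1\<close> agrees with
        \<open>exp (p * (0 * ln 0)) = 1\<close>.\<close>
      case True
      hence "card {j\<in>{0..<p}. b j = t} = 0" using b(2)[OF t] by (simp only: mult_zero_right of_nat_eq_0_iff)
      thus ?thesis using True by (simp only: power_0) simp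
    next
      case False
      hence "w t > 0" using w[OF t] by simp
      hence "w t ^ card {j\<in>{0..<p}. b j = t} = exp (real (card {j\<in>{0..<p}. b j = t}) * ln (w t))"
        by (subst exp_of_nat_mult) simp
      thus ?thesis using b(2)[OF t] by (simp add: mult_ac)
    qed
  qed
  also have "\<dots> = exp (real p * (\<Sum>t\<in>T. w t * ln (w t)))"
    using T by (simp add: exp_sum sum_distrib_left)
  finally show ?thesis .
qed

text \<open>The vectors of \<open>F\<close> share one weight under a law of total mass 1, so their
  number is at most the inverse of that weight. The alphabet \<open>T\<close> is arbitrary so that
  the bound can serve for merged labels.\<close>

lemma card_type_class_le:
  fixes w :: "'a \<Rightarrow> real"
  assumes T: "finite T" and w: "\<And>t. t \<in> T \<Longrightarrow> w t \<ge> 0" and w1: "(\<Sum>t\<in>T. w t) = 1"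
    and F: "F \<subseteq> {0..<p} \<rightarrow>\<^sub>E T"
      "\<And>b t. b \<in> F \<Longrightarrow> t \<in> T \<Longrightarrow> real (card {j\<in>{0..<p}. b j = t}) = real p * w t"
  shows "real (card F) \<le> exp (- real p * (\<Sum>t\<in>T. w t * ln (w t)))"
proof -
  have "real (card F) * exp (real p * (\<Sum>t\<in>T. w t * ln (w t))) = (\<Sum>b\<in>F. \<Prod>j\<in>{0..<p}. w (b j))"
  proof -
    have "(\<Prod>j\<in>{0..<p}. w (b j)) = exp (real p * (\<Sum>t\<in>T. w t * ln (w t)))" if "b \<in> F" for b
      by (rule prod_weights_of_type) (use that F T w in \<open>auto simp: PiE_iff\<close>)
    thus ?thesis by simp
  qed
  also have "\<dots> \<le> (\<Sum>b\<in>{0..<p} \<rightarrow>\<^sub>E T. \<Prod>j\<in>{0..<p}. w (b j))"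
    by (rule sum_mono2) (use F T w in \<open>auto intro!: finite_PiE prod_nonneg simp: PiE_iff\<close>)
  also have "\<dots> = (\<Prod>j\<in>{0..<p}. \<Sum>t\<in>T. w t)"
    by (rule prod_sum_PiE[symmetric]) (use T in auto)
  finally show ?thesis using w1 by (simp add: exp_minus field_simps)
qed

text \<open>Converse of the preceding bound up to a polynomial factor. In the multinomial
  coefficient the terms with \<open>ln p - 1\<close> add up to \<open>p * (ln p - 1)\<close> and
  cancel against the lower estimate of \<open>ln (fact p)\<close>; the remainders
  \<open>1 + ln (p + 1)\<close> of the \<open>d\<close> labels form the polynomial factor. In
  particular \<open>Bset\<close> is nonempty.\<close>

lemma card_Bset_ge:
  assumes pi: "\<forall>t\<in>{1..d}. \<pi> t \<ge> 0" "(\<Sum>t\<in>{1..d}. \<pi> t) = 1"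
    and int: "\<forall>t\<in>{1..d}. real p * \<pi> t \<in> \<int>" 
  shows "real (card (Bset d \<pi> p)) * (exp 1 * (real p + 1)) ^ d
           \<ge> exp (- real p * (\<Sum>t\<in>{1..d}. \<pi> t * ln (\<pi> t)))"
proof (cases "p = 0")
  case True
  have "Bset d \<pi> p = {\<lambda>_. undefined}" using True by (auto simp: Bset_def)
  thus ?thesis using True by simp
next
  case False
  define m where "m t = nat \<lfloor>real p * \<pi> t\<rfloor>" for t
  have m: "real (m t) = real p * \<pi> t" if "t \<in> {1..d}" for t
    using int pi that by (auto simp: m_def elim!: Ints_cases)
  have "real (\<Sum>t\<in>{1..d}. m t) = (\<Sum>t\<in>{1..d}. real p * \<pi> t)"
    using m by simp
  also have "\<dots> = real p"
    using pi by (simp add: sum_distrib_left[symmetric])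
  finally have ms: "(\<Sum>t\<in>{1..d}. m t) = p" by linarith
  have B: "Bset d \<pi> p = {b \<in> {0..<p} \<rightarrow>\<^sub>E {1..d}. \<forall>t\<in>{1..d}. card {j\<in>{0..<p}. b j = t} = m t}"
    unfolding Bset_def using m by (metis (no_types, lifting) of_nat_eq_iff)
  have "card (Bset d \<pi> p) * (\<Prod>t\<in>{1..d}. fact (m t)) = fact p"
    unfolding B by (rule card_functions_with_counts) (use ms in auto)
  hence "real (card (Bset d \<pi> p)) * (\<Prod>t\<in>{1..d}. fact (m t)) = fact p"
    by (metis (mono_tags, lifting) of_nat_fact of_nat_mult of_nat_prod prod.cong)
  moreover from this have pos: "real (card (Bset d \<pi> p)) > 0"
    by (metis fact_nonzero mult_eq_0_iff of_nat_0_le_iff order_le_less)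
  ultimately have "ln (real (card (Bset d \<pi> p))) + (\<Sum>t\<in>{1..d}. ln (fact (m t))) = ln (fact p)"
    using ln_mult_pos[OF pos, of "\<Prod>t\<in>{1..d}. fact (m t)"]
    by (simp add: ln_prod prod_pos)
  moreover have "(\<Sum>t\<in>{1..d}. ln (fact (m t)))
      \<le> (\<Sum>t\<in>{1..d}. real p * (\<pi> t * ln (\<pi> t)) + real p * \<pi> t * (ln p - 1) + (1 + ln (real p + 1)))"
  proof (rule sum_mono)
    fix t assume t: "t \<in> {1..d}"
    have "m t \<le> p" using ms t by (metis finite_atLeastAtMost member_le_sum zero_le)
    hence "ln (real (m t) + 1) \<le> ln (real p + 1)" by simp
    moreover have "real (m t) * ln (real (m t)) = real p * (\<pi> t * ln (\<pi> t)) + real p * \<pi> t * ln p"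
    proof (cases "\<pi> t = 0")
      case False
      hence "\<pi> t > 0" using pi t by force
      thus ?thesis using m[OF t] \<open>p \<noteq> 0\<close> by (simp add: ln_mult algebra_simps)
    qed (use m[OF t] in auto)
    ultimately show "ln (fact (m t)) \<le> real p * (\<pi> t * ln (\<pi> t)) + real p * \<pi> t * (ln p - 1) + (1 + ln (real p + 1))"
      using ln_fact_le[of "m t"] m[OF t] unfolding right_diff_distrib mult_1_right by linarith
  qed
  moreover have "\<dots> = real p * (\<Sum>t\<in>{1..d}. \<pi> t * ln (\<pi> t)) + real p * (ln p - 1) + real d * (1 + ln (real p + 1))"
    using pi by (simp add: sum.distrib sum_distrib_left[symmetric] sum_distrib_right[symmetric])
  ultimately have "- real p * (\<Sum>t\<in>{1..d}. \<pi> t * ln (\<pi> t)) \<le> ln (real (card (Bset d \<pi> p))) + real d * (1 + ln (real p + 1))"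
    using ln_fact_ge[of p] by (simp add: algebra_simps)
  also have "\<dots> = ln (real (card (Bset d \<pi> p)) * (exp 1 * (real p + 1)) ^ d)"
    using pos by (simp add: ln_mult ln_realpow)
  finally show ?thesis
    using pos by (subst (asm) ln_ge_iff) auto
qed

section \<open>Concentration of the counts in a test\<close>

lemma exp_le_quadratic:
  fixes x :: real
  assumes "\<bar>x\<bar> \<le> 1"
  shows "exp x \<le> 1 + x + x\<^sup>2"
proof (cases "x \<ge> 0")
  case True
  thus ?thesis using assms by (intro exp_bound) auto
next
  case False
  define y where "y = - x"
  have y: "y > 0" "y \<le> 1" using False assms by (auto simp: y_def)
  have q: "1 - y + y\<^sup>2 > 0" using y by (simp add: add_nonneg_pos)
  \<comment> \<open>The right-hand side is \<open>1 + y ^ 3\<close>; the factor \<open>1 + y\<close>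
    is then replaced by the larger \<open>exp y\<close>.\<close>
  have "1 \<le> (1 + y) * (1 - y + y\<^sup>2)"
    using y by (simp add: power2_eq_square algebra_simps)
  also have "\<dots> \<le> exp y * (1 - y + y\<^sup>2)"
    using q by (intro mult_right_mono) auto
  finally show ?thesis by (simp add: y_def exp_minus field_simps)
qed

text \<open>For the centred Bernoulli variable the linear terms of the two quadratic estimates
  cancel, and the variance \<open>q * (1 - q)\<close> is at most 1.\<close>

lemma bernoulli_mgf_le:
  fixes q l :: real
  assumes "0 \<le> q" "q \<le> 1" "\<bar>l\<bar> \<le> 1"
  shows "q * exp (l * (1 - q)) + (1 - q) * exp (l * (0 - q)) \<le> exp (l\<^sup>2)"
proof -
  have "\<bar>l * (1 - q)\<bar> \<le> 1" "\<bar>l * (0 - q)\<bar> \<le> 1"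
    using assms by (auto simp: abs_mult mult_le_one)
  hence "q * exp (l * (1 - q)) + (1 - q) * exp (l * (0 - q))
      \<le> q * (1 + l * (1 - q) + (l * (1 - q))\<^sup>2) + (1 - q) * (1 + l * (0 - q) + (l * (0 - q))\<^sup>2)"
    using assms by (intro add_mono mult_left_mono exp_le_quadratic) auto
  also have "\<dots> = 1 + l\<^sup>2 * (q * (1 - q))"
    by (simp add: power2_eq_square algebra_simps)
  also have "\<dots> \<le> 1 + l\<^sup>2 * 1"
    using assms by (intro add_left_mono mult_left_mono mult_le_one) auto
  also have "\<dots> \<le> exp (l\<^sup>2)" by simp
  finally show ?thesis .
qed

text \<open>Under the product law the count over \<open>I\<close> is a sum of independent Bernoulli
  variables, so its moment generating function factors over positions. A position in
  \<open>I\<close> contributes at most \<open>exp (l\<^sup>2)\<close>, any other exactly 1; bounding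
  all \<open>p\<close> positions alike makes the estimate independent of \<open>I\<close>.\<close>

lemma product_weight_mgf_le:
  fixes w :: "'a \<Rightarrow> real" and l :: real
  assumes T: "finite T" "t \<in> T" and w: "\<And>u. u \<in> T \<Longrightarrow> w u \<ge> 0" and w1: "(\<Sum>u\<in>T. w u) = 1"
    and I: "I \<subseteq> {0..<p}" and l: "\<bar>l\<bar> \<le> 1"
  shows "(\<Sum>b\<in>{0..<p} \<rightarrow>\<^sub>E T. (\<Prod>j\<in>{0..<p}. w (b j)) *
            exp (l * (real (card {j\<in>I. b j = t}) - real (card I) * w t))) \<le> exp (real p * l\<^sup>2)"
proof -
  have fI: "finite I" using I finite_subset by blast
  define g where "g j u = w u * (if j \<in> I then exp (l * (of_bool (u = t) - w t)) else 1)" for j u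
  have *: "(\<Prod>j\<in>{0..<p}. w (b j)) * exp (l * (real (card {j\<in>I. b j = t}) - real (card I) * w t))
      = (\<Prod>j\<in>{0..<p}. g j (b j))" for b
  proof -
    have "real (card {j\<in>I. b j = t}) - real (card I) * w t = (\<Sum>j\<in>I. of_bool (b j = t) - w t)"
      using fI by (simp add: sum_subtractf of_bool_def sum.If_cases Int_def)
    hence "exp (l * (real (card {j\<in>I. b j = t}) - real (card I) * w t))
        = (\<Prod>j\<in>I. exp (l * (of_bool (b j = t) - w t)))"
      using fI by (simp add: sum_distrib_left exp_sum)
    also have "\<dots> = (\<Prod>j\<in>{0..<p}. if j \<in> I then exp (l * (of_bool (b j = t) - w t)) else 1)"
      using I by (intro prod.mono_neutral_cong_left) auto
    finally show ?thesis by (simp add: g_def prod.distrib)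
  qed
  have wt: "0 \<le> w t" "w t \<le> 1"
    using w T member_le_sum[of t T w] w1 by auto
  have rest: "(\<Sum>u\<in>T - {t}. w u) = 1 - w t"
    using T w1 by (simp add: sum_diff1)
  have "(\<Sum>b\<in>{0..<p} \<rightarrow>\<^sub>E T. \<Prod>j\<in>{0..<p}. g j (b j)) = (\<Prod>j\<in>{0..<p}. \<Sum>u\<in>T. g j u)"
    by (rule prod_sum_PiE[symmetric]) (use T in auto)
  also have "\<dots> \<le> (\<Prod>j\<in>{0..<p}. exp (l\<^sup>2))"
  proof (intro prod_mono conjI)
    fix j
    show "0 \<le> (\<Sum>u\<in>T. g j u)" by (intro sum_nonneg) (auto simp: g_def w)
    show "(\<Sum>u\<in>T. g j u) \<le> exp (l\<^sup>2)"
    proof (cases "j \<in> I")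
      case True
      have "(\<Sum>u\<in>T. g j u) = g j t + (\<Sum>u\<in>T - {t}. g j u)"
        using T by (rule sum.remove)
      also have "(\<Sum>u\<in>T - {t}. g j u) = (\<Sum>u\<in>T - {t}. w u) * exp (l * (0 - w t))"
        unfolding sum_distrib_right using True by (intro sum.cong) (auto simp: g_def)
      also have "g j t = w t * exp (l * (1 - w t))" using True by (simp add: g_def)
      finally show ?thesis unfolding rest using bernoulli_mgf_le[OF wt l] by simp
    qed (use w1 in \<open>simp add: g_def\<close>)
  qed
  also have "\<dots> = exp (real p * l\<^sup>2)"
    by (simp add: exp_of_nat_mult)
  finally show ?thesis by (simp only: *)
qed

text \<open>Two-sided Chernoff bound with \<open>l\<close> left free. Markov's inequality is applied
  to \<open>exp (l * D) + exp (- l * D)\<close>, which dominates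
  \<open>exp (l * \<bar>D\<bar>)\<close> and so treats both tails at once.\<close>

lemma product_weight_deviation_le:
  fixes w :: "'a \<Rightarrow> real" and l s :: real
  assumes T: "finite T" "t \<in> T" and w: "\<And>u. u \<in> T \<Longrightarrow> w u \<ge> 0" and w1: "(\<Sum>u\<in>T. w u) = 1"
    and I: "I \<subseteq> {0..<p}" and l: "0 \<le> l" "l \<le> 1"
  shows "(\<Sum>b\<in>{b \<in> {0..<p} \<rightarrow>\<^sub>E T. \<bar>real (card {j\<in>I. b j = t}) - real (card I) * w t\<bar> \<ge> s}.
            \<Prod>j\<in>{0..<p}. w (b j)) \<le> 2 * exp (real p * l\<^sup>2 - l * s)"
proof -
  define D where "D b = real (card {j\<in>I. b j = t}) - real (card I) * w t" for b
  define W where "W b = (\<Prod>j\<in>{0..<p}. w (b j))" for b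
  let ?P = "{0..<p} \<rightarrow>\<^sub>E T"
  have fin: "finite ?P" using T by (intro finite_PiE) auto
  have W: "W b \<ge> 0" if "b \<in> ?P" for b
    unfolding W_def using that w by (intro prod_nonneg) (auto simp: PiE_iff)
  have "(\<Sum>b\<in>{b \<in> ?P. \<bar>D b\<bar> \<ge> s}. W b)
      \<le> (\<Sum>b\<in>{b \<in> ?P. \<bar>D b\<bar> \<ge> s}. (W b * exp (l * D b) + W b * exp ((- l) * D b)) * exp (- l * s))"
  proof (rule sum_mono)
    fix b assume b: "b \<in> {b \<in> ?P. \<bar>D b\<bar> \<ge> s}"
    have "1 \<le> exp (l * (\<bar>D b\<bar> - s))" using b l by simp
    also have "\<dots> = exp (l * \<bar>D b\<bar>) * exp (- l * s)"
      by (simp add: right_diff_distrib flip: exp_add)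
    also have "\<dots> \<le> (exp (l * D b) + exp ((- l) * D b)) * exp (- l * s)"
      by (intro mult_right_mono) (auto simp: abs_if)
    finally have "W b * 1 \<le> W b * ((exp (l * D b) + exp ((- l) * D b)) * exp (- l * s))"
      using b W by (intro mult_left_mono) auto
    thus "W b \<le> (W b * exp (l * D b) + W b * exp ((- l) * D b)) * exp (- l * s)"
      by (simp add: algebra_simps)
  qed
  also have "\<dots> \<le> (\<Sum>b\<in>?P. (W b * exp (l * D b) + W b * exp ((- l) * D b)) * exp (- l * s))"
    by (rule sum_mono2) (use fin W in auto)
  also have "\<dots> = ((\<Sum>b\<in>?P. W b * exp (l * D b)) + (\<Sum>b\<in>?P. W b * exp ((- l) * D b))) * exp (- l * s)"
    unfolding sum.distrib[symmetric] sum_distrib_right ..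
  also have "\<dots> \<le> (exp (real p * l\<^sup>2) + exp (real p * (- l)\<^sup>2)) * exp (- l * s)"
    unfolding W_def D_def
    by (intro mult_right_mono add_mono product_weight_mgf_le) (use assms in auto)
  also have "\<dots> = 2 * exp (real p * l\<^sup>2 - l * s)"
    by (simp add: exp_diff exp_minus field_simps)
  finally show ?thesis unfolding W_def D_def .
qed

lemma finite_Bset: "finite (Bset d \<pi> p)"
  unfolding Bset_def by (rule finite_subset[of _ "{0..<p} \<rightarrow>\<^sub>E {1..d}"]) (auto intro: finite_PiE)

text \<open>Change of measure: on \<open>Bset\<close> the i.i.d. law has the constant weight
  \<open>exp (p * h)\<close>, whose inverse is at most \<open>card (Bset d \<pi> p)\<close> times
  the polynomial factor. The Chernoff bound for independent labels therefore carries over to the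
  uniform law, at the cost of that factor.\<close>

lemma card_Bset_deviation_le:
  assumes pi: "\<forall>t\<in>{1..d}. \<pi> t \<ge> 0" "(\<Sum>t\<in>{1..d}. \<pi> t) = 1"
    and int: "\<forall>t\<in>{1..d}. real p * \<pi> t \<in> \<int>" and t: "t \<in> {1..d}" and l: "0 \<le> l" "l \<le> (1::real)"
  shows "real (card {b \<in> Bset d \<pi> p. \<bar>real (Ncount p b x t) - real (card {j\<in>{0..<p}. x j}) * \<pi> t\<bar> \<ge> s})
      \<le> real (card (Bset d \<pi> p)) * (exp 1 * (real p + 1)) ^ d * (2 * exp (real p * l\<^sup>2 - l * s))"
    (is "real (card ?A) \<le> ?C * ?E")
proof -
  define h where "h = (\<Sum>t\<in>{1..d}. \<pi> t * ln (\<pi> t))"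
  let ?I = "{j\<in>{0..<p}. x j}"
  have N: "Ncount p b x t = card {j\<in>?I. b j = t}" for b
    unfolding Ncount_def by (rule arg_cong[where f = card]) auto
  have "(\<Prod>j\<in>{0..<p}. \<pi> (b j)) = exp (real p * h)" if "b \<in> Bset d \<pi> p" for b
    unfolding h_def by (rule prod_weights_of_type) (use that pi in \<open>auto simp: Bset_def PiE_iff\<close>)
  hence "real (card ?A) * exp (real p * h) = (\<Sum>b\<in>?A. \<Prod>j\<in>{0..<p}. \<pi> (b j))"
    by simp
  also have "\<dots> \<le> (\<Sum>b\<in>{b \<in> {0..<p} \<rightarrow>\<^sub>E {1..d}. \<bar>real (card {j\<in>?I. b j = t}) - real (card ?I) * \<pi> t\<bar> \<ge> s}.
            \<Prod>j\<in>{0..<p}. \<pi> (b j))"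
  proof (rule sum_mono2)
    show "finite {b \<in> {0..<p} \<rightarrow>\<^sub>E {1..d}. \<bar>real (card {j\<in>?I. b j = t}) - real (card ?I) * \<pi> t\<bar> \<ge> s}"
      by (rule finite_subset[of _ "{0..<p} \<rightarrow>\<^sub>E {1..d}"]) (auto intro: finite_PiE)
  next
    show "?A \<subseteq> {b \<in> {0..<p} \<rightarrow>\<^sub>E {1..d}. \<bar>real (card {j\<in>?I. b j = t}) - real (card ?I) * \<pi> t\<bar> \<ge> s}"
      unfolding N by (auto simp: Bset_def)
  qed (use pi in \<open>auto intro!: prod_nonneg simp: PiE_iff\<close>)
  also have "\<dots> \<le> ?E"
    by (rule product_weight_deviation_le) (use pi t l in auto)
  finally have "real (card ?A) \<le> exp (- real p * h) * ?E"
    by (simp add: exp_minus field_simps)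
  also have "\<dots> \<le> ?C * ?E"
    using card_Bset_ge[OF pi int] by (intro mult_right_mono) (auto simp: h_def)
  finally show ?thesis .
qed

section \<open>Hamming balls and ranges of counts\<close>

lemma card_hamming_ball_le:
  assumes "d \<ge> 1"
  shows "card {b \<in> {0..<p} \<rightarrow>\<^sub>E {1..d}. card {j\<in>{0..<p}. c j \<noteq> b j} \<le> q}
      \<le> (\<Sum>i\<le>q. (p choose i) * (d - 1) ^ i)"
proof -
  \<comment> \<open>The centre may have letters outside the alphabet; moving them inside only enlarges the ball.\<close>
  define c' where "c' j = (if c j \<in> {1..d} then c j else 1)" for j
  \<comment> \<open>\<open>F J\<close> holds the vectors that differ from \<open>c'\<close> exactly
    on \<open>J\<close>, with \<open>d - 1\<close> choices at each position of \<open>J\<close>;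
    \<open>K i\<close> collects the error sets of size \<open>i\<close>.\<close>
  define F where "F J = (\<Pi>\<^sub>E j\<in>{0..<p}. if j \<in> J then {1..d} - {c' j} else {c' j})" for J
  define K where "K i = {J. J \<subseteq> {0..<p} \<and> card J = i}" for i
  have c': "c' j \<in> {1..d}" for j using assms by (auto simp: c'_def)
  have finK: "finite (K i)" for i unfolding K_def by (rule finite_subset[of _ "Pow {0..<p}"]) auto
  have cF: "card (F J) = (d - 1) ^ card J" if "J \<subseteq> {0..<p}" for J
  proof -
    have "card (F J) = (\<Prod>j\<in>{0..<p}. if j \<in> J then d - 1 else 1)"
      unfolding F_def using c' by (subst card_PiE) (auto intro!: prod.cong)
    also have "\<dots> = (\<Prod>j\<in>J. d - 1)"
      using that by (intro prod.mono_neutral_cong_right) auto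
    finally show ?thesis by simp
  qed
  have finF: "finite (F J)" for J unfolding F_def by (intro finite_PiE) auto
  have "{b \<in> {0..<p} \<rightarrow>\<^sub>E {1..d}. card {j\<in>{0..<p}. c j \<noteq> b j} \<le> q} \<subseteq> (\<Union>i\<le>q. \<Union>J\<in>K i. F J)"
  proof safe
    fix b assume b: "b \<in> {0..<p} \<rightarrow>\<^sub>E {1..d}" "card {j\<in>{0..<p}. c j \<noteq> b j} \<le> q"
    define J where "J = {j\<in>{0..<p}. c' j \<noteq> b j}"
    have "J \<subseteq> {j\<in>{0..<p}. c j \<noteq> b j}"
      using b(1) by (auto simp: J_def c'_def PiE_iff split: if_splits)
    hence "card J \<le> card {j\<in>{0..<p}. c j \<noteq> b j}" by (intro card_mono) auto
    moreover have "b \<in> F J" using b(1) by (auto simp: F_def J_def PiE_iff)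
    moreover have "J \<in> K (card J)" by (auto simp: K_def J_def)
    ultimately show "b \<in> (\<Union>i\<le>q. \<Union>J\<in>K i. F J)" using b(2) by force
  qed
  hence "card {b \<in> {0..<p} \<rightarrow>\<^sub>E {1..d}. card {j\<in>{0..<p}. c j \<noteq> b j} \<le> q} \<le> card (\<Union>i\<le>q. \<Union>J\<in>K i. F J)"
    by (intro card_mono) (auto intro: finK finF)
  also have "\<dots> \<le> (\<Sum>i\<le>q. card (\<Union>J\<in>K i. F J))"
    by (rule card_UN_le) simp
  also have "\<dots> \<le> (\<Sum>i\<le>q. \<Sum>J\<in>K i. card (F J))"
    by (intro sum_mono card_UN_le finK)
  also have "\<dots> = (\<Sum>i\<le>q. \<Sum>J\<in>K i. (d - 1) ^ i)"
    by (intro sum.cong refl) (auto simp: K_def cF)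
  also have "\<dots> = (\<Sum>i\<le>q. (p choose i) * (d - 1) ^ i)"
    by (simp add: K_def n_subsets)
  finally show ?thesis .
qed

lemma card_nat_window_le:
  fixes a s :: real
  assumes "s \<ge> 0"
  shows "finite {k::nat. \<bar>real k - a\<bar> < s}" "real (card {k::nat. \<bar>real k - a\<bar> < s}) \<le> 2 * s + 1"
proof -
  have sub: "int ` {k::nat. \<bar>real k - a\<bar> < s} \<subseteq> {\<lceil>a - s\<rceil>..\<lfloor>a + s\<rfloor>}"
    by (auto simp: ceiling_le_iff le_floor_iff abs_less_iff)
  show fin: "finite {k::nat. \<bar>real k - a\<bar> < s}"
    using sub finite_imageD[of int] finite_subset by (metis finite_atLeastAtMost_int inj_on_of_nat)
  have "card {k::nat. \<bar>real k - a\<bar> < s} = card (int ` {k::nat. \<bar>real k - a\<bar> < s})"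
    by (simp add: card_image)
  also have "\<dots> \<le> card {\<lceil>a - s\<rceil>..\<lfloor>a + s\<rfloor>}"
    using sub by (intro card_mono) auto
  finally have "real (card {k::nat. \<bar>real k - a\<bar> < s}) \<le> real (nat (\<lfloor>a + s\<rfloor> - \<lceil>a - s\<rceil> + 1))"
    by simp
  also have "\<dots> \<le> 2 * s + 1" using assms by linarith
  finally show "real (card {k::nat. \<bar>real k - a\<bar> < s}) \<le> 2 * s + 1" .
qed

section \<open>Merged labels and the number of typical successes\<close>

lemma sum_Ncount:
  assumes "finite S"
  shows "(\<Sum>t\<in>S. Ncount p b x t) = card {j\<in>{0..<p}. b j \<in> S \<and> x j}"
proof -
  have "{j\<in>{0..<p}. b j \<in> S \<and> x j} = (\<Union>t\<in>S. {j\<in>{0..<p}. b j = t \<and> x j})" by auto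
  moreover have "card (\<Union>t\<in>S. {j\<in>{0..<p}. b j = t \<and> x j}) = (\<Sum>t\<in>S. card {j\<in>{0..<p}. b j = t \<and> x j})"
    using assms by (intro card_UN_disjoint) auto
  ultimately show ?thesis by (simp only: Ncount_def)
qed

text \<open>Labels start at 1, so 0 is free to stand for the merged label.\<close>
definition merge_labels :: "nat set \<Rightarrow> nat \<Rightarrow> (nat \<Rightarrow> nat) \<Rightarrow> nat \<Rightarrow> nat" where
  "merge_labels S p b = (\<lambda>j\<in>{0..<p}. if b j \<in> S then 0 else b j)"

text \<open>Merging sends all of \<open>Bset\<close> into a single type class, over the alphabet in
  which 0 replaces \<open>S\<close> and carries the total weight of \<open>S\<close>. The exponent
  is \<open>p\<close> times the entropy of this merged law.\<close>

lemma card_merged_Bset_le: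
  assumes pi: "\<forall>t\<in>{1..d}. \<pi> t \<ge> 0" "(\<Sum>t\<in>{1..d}. \<pi> t) = 1" and S: "S \<subseteq> {1..d}"
  shows "real (card (merge_labels S p ` Bset d \<pi> p))
    \<le> exp (- real p * ((\<Sum>t\<in>S. \<pi> t) * ln (\<Sum>t\<in>S. \<pi> t) + (\<Sum>t\<in>{1..d} - S. \<pi> t * ln (\<pi> t))))"
proof -
  define w where "w t = (if t = 0 then \<Sum>t\<in>S. \<pi> t else \<pi> t)" for t :: nat
  let ?T = "insert 0 ({1..d} - S)"
  have fS: "finite S" using S finite_subset by blast
  have rest: "(\<Sum>t\<in>{1..d} - S. w t) = (\<Sum>t\<in>{1..d} - S. \<pi> t)"
    by (intro sum.cong) (auto simp: w_def)
  have "real (card (merge_labels S p ` Bset d \<pi> p)) \<le> exp (- real p * (\<Sum>t\<in>?T. w t * ln (w t)))"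
  proof (rule card_type_class_le)
    show "w t \<ge> 0" if "t \<in> ?T" for t
      using that pi S by (auto simp: w_def intro!: sum_nonneg)
    have "(\<Sum>t\<in>?T. w t) = (\<Sum>t\<in>S. \<pi> t) + (\<Sum>t\<in>{1..d} - S. \<pi> t)"
      using rest by (simp add: w_def)
    also have "\<dots> = 1" using pi(2) S by (metis add.commute finite_atLeastAtMost sum.subset_diff)
    finally show "(\<Sum>t\<in>?T. w t) = 1" .
    show "merge_labels S p ` Bset d \<pi> p \<subseteq> {0..<p} \<rightarrow>\<^sub>E ?T"
      by (auto simp: merge_labels_def Bset_def PiE_iff split: if_splits)
  next
    fix b' t assume "b' \<in> merge_labels S p ` Bset d \<pi> p" and t: "t \<in> ?T"
    then obtain b where b: "b \<in> Bset d \<pi> p" and b': "b' = merge_labels S p b" by auto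
    have cnt: "real (card {j\<in>{0..<p}. b j = t}) = real p * \<pi> t" if "t \<in> {1..d}" for t
      using b that by (auto simp: Bset_def)
    show "real (card {j\<in>{0..<p}. b' j = t}) = real p * w t"
    proof (cases "t = 0")
      case True
      \<comment> \<open>Original labels are at least 1, so a 0 arises only by merging.\<close>
      have "b j \<noteq> 0" if "j < p" for j
        using b that by (force simp: Bset_def PiE_iff)
      hence "(if b j \<in> S then 0 else b j) = 0 \<longleftrightarrow> b j \<in> S" if "j < p" for j
        using that by simp
      \<comment> \<open>The conjunct \<open>True\<close> stands for the test containing every item,
        for which \<open>Ncount\<close> is the plain number of occurrences of a label.\<close>
      hence "{j\<in>{0..<p}. b' j = t} = {j\<in>{0..<p}. b j \<in> S \<and> True}"
        using True by (auto simp: b' merge_labels_def simp del: if_split cong: conj_cong)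
      hence "real (card {j\<in>{0..<p}. b' j = t}) = (\<Sum>t\<in>S. real (Ncount p b (\<lambda>_. True) t))"
        using sum_Ncount[OF fS, of p b "\<lambda>_. True"] by (metis of_nat_sum)
      also have "\<dots> = (\<Sum>t\<in>S. real p * \<pi> t)"
        by (intro sum.cong refl) (use S cnt in \<open>auto simp: Ncount_def\<close>)
      finally show ?thesis using True by (simp add: w_def sum_distrib_left)
    next
      case False
      have "{j\<in>{0..<p}. b' j = t} = {j\<in>{0..<p}. b j = t}"
        using False t by (auto simp: b' merge_labels_def)
      thus ?thesis using False t cnt by (auto simp: w_def)
    qed
  qed auto
  also have "(\<Sum>t\<in>?T. w t * ln (w t)) = (\<Sum>t\<in>S. \<pi> t) * ln (\<Sum>t\<in>S. \<pi> t) + (\<Sum>t\<in>{1..d} - S. w t * ln (w t))"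
    by (subst sum.insert) (auto simp: w_def)
  also have "(\<Sum>t\<in>{1..d} - S. w t * ln (w t)) = (\<Sum>t\<in>{1..d} - S. \<pi> t * ln (\<pi> t))"
    by (intro sum.cong) (auto simp: w_def)
  finally show ?thesis .
qed

text \<open>Within a merged class the counts of a label outside \<open>S\<close> are known, and so is the total
  over \<open>S\<close>; the outcome therefore depends only on the counts of \<open>card S - 1\<close> labels.\<close>
lemma outcome_eq_of_merged:
  assumes S: "S \<subseteq> {1..d}" "t0 \<in> S" and b: "b \<in> Bset d \<pi> p" "b' \<in> Bset d \<pi> p"
    and m: "merge_labels S p b = merge_labels S p b'"
    and N: "\<And>i t. i < n \<Longrightarrow> t \<in> S - {t0} \<Longrightarrow> Ncount p b (X i) t = Ncount p b' (X i) t"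
  shows "outcome n p X b = outcome n p X b'"
proof (intro ext)
  fix i t
  have fS: "finite S" using S finite_subset by blast
  have mj: "(if b j \<in> S then 0 else b j) = (if b' j \<in> S then 0 else b' j)" if "j < p" for j
    using fun_cong[OF m, of j] that by (simp add: merge_labels_def)
  have r: "b j \<in> {1..d}" "b' j \<in> {1..d}" if "j < p" for j
    using b that by (auto simp: Bset_def PiE_iff)
  have "Ncount p b (X i) t = Ncount p b' (X i) t" if i: "i < n"
  proof -
    consider "t \<notin> {1..d}" | "t \<in> {1..d} - S" | "t \<in> S - {t0}" | "t = t0" by blast
    thus ?thesis
    proof cases
      \<comment> \<open>Outcomes are functions of every natural number \<open>t\<close>, so labels
        outside the alphabet have to be covered too; their counts vanish.\<close>
      case 1
      hence "{j\<in>{0..<p}. b j = t \<and> X i j} = {}" "{j\<in>{0..<p}. b' j = t \<and> X i j} = {}"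
        using r by auto
      thus ?thesis unfolding Ncount_def by metis
    next
      case 2
      have "b j = t \<longleftrightarrow> b' j = t" if "j < p" for j
        using mj[OF that] r[OF that] 2 by (auto split: if_splits)
      hence "{j\<in>{0..<p}. b j = t \<and> X i j} = {j\<in>{0..<p}. b' j = t \<and> X i j}" by auto
      thus ?thesis unfolding Ncount_def by metis
    next
      case 3
      thus ?thesis using N i by blast
    next
      case 4
      have "b j \<in> S \<longleftrightarrow> b' j \<in> S" if "j < p" for j
        using mj[OF that] r[OF that] by (auto split: if_splits)
      hence "{j\<in>{0..<p}. b j \<in> S \<and> X i j} = {j\<in>{0..<p}. b' j \<in> S \<and> X i j}" by auto
      hence "(\<Sum>t\<in>S. Ncount p b (X i) t) = (\<Sum>t\<in>S. Ncount p b' (X i) t)"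
        by (simp only: sum_Ncount[OF fS])
      moreover have "(\<Sum>t\<in>S - {t0}. Ncount p b (X i) t) = (\<Sum>t\<in>S - {t0}. Ncount p b' (X i) t)"
        by (intro sum.cong refl N i) auto
      ultimately show ?thesis using 4 S fS by (simp add: sum.remove)
    qed
  qed
  thus "outcome n p X b i t = outcome n p X b' i t" by (simp add: outcome_def)
qed

text \<open>The map \<open>g\<close> sends a vector to its merged version and to the counts of the
  labels in \<open>S - {t0}\<close>. Typicality confines each of these
  \<open>n * (card S - 1)\<close> counts to at most \<open>2 * s + 1\<close> values, which bounds
  the image of \<open>g\<close>, and each fibre of \<open>g\<close> lies in one Hamming
  ball.\<close>

lemma card_typical_success_le:
  fixes c :: "outcomes \<Rightarrow> nat \<Rightarrow> nat" and X :: test_matrix and \<pi> :: "nat \<Rightarrow> real"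
    and d n p q :: nat and s :: real
  assumes S: "S \<subseteq> {1..d}" "S \<noteq> {}" and s: "s \<ge> 0"
  defines "G \<equiv> {b \<in> Bset d \<pi> p.
      (\<forall>i<n. \<forall>t\<in>{1..d}. \<bar>real (Ncount p b (X i) t) - real (card {j\<in>{0..<p}. X i j}) * \<pi> t\<bar> < s) \<and>
      card {j\<in>{0..<p}. c (outcome n p X b) j \<noteq> b j} \<le> q}"
  shows "real (card G) \<le> real (card (merge_labels S p ` Bset d \<pi> p)) * (2 * s + 1) ^ (n * (card S - 1))
            * real (\<Sum>i\<le>q. (p choose i) * (d - 1) ^ i)"
proof -
  obtain t0 where t0: "t0 \<in> S" using S by blast
  have fS: "finite S" using S finite_subset by blast
  have d: "d \<ge> 1" using S by force
  define I where "I = {0..<n} \<times> (S - {t0})"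
  define V where "V = (\<lambda>(i, t). {k::nat. \<bar>real k - real (card {j\<in>{0..<p}. X i j}) * \<pi> t\<bar> < s})"
  define g where "g b = (merge_labels S p b, \<lambda>it\<in>I. Ncount p b (X (fst it)) (snd it))" for b
  define ball where "ball = (\<Sum>i\<le>q. (p choose i) * (d - 1) ^ i)"
  have fI: "finite I" using fS by (simp add: I_def)
  have cI: "card I = n * (card S - 1)" using fS t0 by (simp add: I_def card_cartesian_product)
  have fG: "finite G" unfolding G_def using finite_Bset by auto
  have fV: "finite (V it)" for it
    using card_nat_window_le(1)[OF s] by (cases it) (simp add: V_def)
  have sub: "g ` G \<subseteq> (merge_labels S p ` Bset d \<pi> p) \<times> (\<Pi>\<^sub>E it\<in>I. V it)"
  proof (rule image_subsetI)
    fix b assume b: "b \<in> G"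
    have "Ncount p b (X (fst it)) (snd it) \<in> V it" if "it \<in> I" for it
      using b that S by (cases it) (auto simp: G_def I_def V_def)
    thus "g b \<in> (merge_labels S p ` Bset d \<pi> p) \<times> (\<Pi>\<^sub>E it\<in>I. V it)"
      using b by (auto simp: g_def G_def)
  qed
  have "real (card (\<Pi>\<^sub>E it\<in>I. V it)) = (\<Prod>it\<in>I. real (card (V it)))"
    using fI by (simp add: card_PiE)
  also have "\<dots> \<le> (\<Prod>it\<in>I. 2 * s + 1)"
    by (intro prod_mono) (auto simp: V_def card_nat_window_le[OF s])
  finally have cV: "real (card (\<Pi>\<^sub>E it\<in>I. V it)) \<le> (2 * s + 1) ^ (n * (card S - 1))"
    by (simp add: cI)
  have "card (g ` G) \<le> card ((merge_labels S p ` Bset d \<pi> p) \<times> (\<Pi>\<^sub>E it\<in>I. V it))"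
    by (rule card_mono[OF _ sub]) (use fI fV finite_Bset in \<open>auto intro!: finite_PiE\<close>)
  hence "real (card (g ` G)) \<le> real (card (merge_labels S p ` Bset d \<pi> p)) * real (card (\<Pi>\<^sub>E it\<in>I. V it))"
    unfolding card_cartesian_product by (simp flip: of_nat_mult)
  also have "\<dots> \<le> real (card (merge_labels S p ` Bset d \<pi> p)) * (2 * s + 1) ^ (n * (card S - 1))"
    using cV by (intro mult_left_mono) auto
  finally have cg: "real (card (g ` G)) \<le> real (card (merge_labels S p ` Bset d \<pi> p)) * (2 * s + 1) ^ (n * (card S - 1))" .
  have fib: "card {b \<in> G. g b = z} \<le> ball" if "z \<in> g ` G" for z
  proof -
    from that obtain a where a: "a \<in> G" "z = g a" by auto
    \<comment> \<open>All vectors of a fibre have the outcome of \<open>a\<close>, so the decoder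
      returns the same vector for each of them; success places them all in the ball around
      it.\<close>
    have "{b \<in> G. g b = z} \<subseteq> {b \<in> {0..<p} \<rightarrow>\<^sub>E {1..d}. card {j\<in>{0..<p}. c (outcome n p X a) j \<noteq> b j} \<le> q}"
    proof (intro subsetI CollectI conjI)
      fix b assume "b \<in> {b \<in> G. g b = z}"
      hence b: "b \<in> G" "z = g b" by auto
      have "outcome n p X a = outcome n p X b"
      proof (rule outcome_eq_of_merged[OF S(1) t0])
        show "Ncount p a (X i) t = Ncount p b (X i) t" if "i < n" "t \<in> S - {t0}" for i t
        proof -
          have "snd (g a) (i, t) = snd (g b) (i, t)" using a b by simp
          thus ?thesis using that by (simp add: g_def I_def)
        qed
      qed (use a b in \<open>auto simp: G_def g_def\<close>)
      thus "card {j\<in>{0..<p}. c (outcome n p X a) j \<noteq> b j} \<le> q" using b by (simp add: G_def)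
      show "b \<in> {0..<p} \<rightarrow>\<^sub>E {1..d}" using b by (simp add: G_def Bset_def)
    qed
    hence "card {b \<in> G. g b = z} \<le> card {b \<in> {0..<p} \<rightarrow>\<^sub>E {1..d}. card {j\<in>{0..<p}. c (outcome n p X a) j \<noteq> b j} \<le> q}"
      by (rule card_mono[rotated]) (rule finite_subset[of _ "{0..<p} \<rightarrow>\<^sub>E {1..d}"], auto intro: finite_PiE)
    also have "\<dots> \<le> ball" unfolding ball_def by (rule card_hamming_ball_le[OF d])
    finally show ?thesis .
  qed
  have "card G = card (\<Union>z\<in>g ` G. {b \<in> G. g b = z})"
    by (rule arg_cong[where f = card]) auto
  also have "\<dots> \<le> (\<Sum>z\<in>g ` G. card {b \<in> G. g b = z})"
    using fG by (intro card_UN_le) auto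
  also have "\<dots> \<le> card (g ` G) * ball"
    using fib sum_bounded_above[of "g ` G" "\<lambda>z. card {b \<in> G. g b = z}" ball] by simp
  finally have "real (card G) \<le> real (card (g ` G)) * real ball" by (simp flip: of_nat_mult)
  also have "\<dots> \<le> (real (card (merge_labels S p ` Bset d \<pi> p)) * (2 * s + 1) ^ (n * (card S - 1))) * real ball"
    using cg by (intro mult_right_mono) auto
  finally show ?thesis unfolding ball_def .
qed

section \<open>Entropies as sums over labels\<close>

lemma ent_pvec: "ent (pvec d \<pi>) = - (\<Sum>t\<in>{1..d}. \<pi> t * ln (\<pi> t))"
proof -
  have "(\<Sum>t\<leftarrow>[1..<d+1]. \<pi> t * ln (\<pi> t)) = (\<Sum>t\<in>set [1..<d+1]. \<pi> t * ln (\<pi> t))"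
    by (rule sum_list_distinct_conv_sum_set) simp
  also have "set [1..<d+1] = {1..d}" by auto
  finally show ?thesis by (simp add: ent_def pvec_def o_def)
qed

text \<open>\<open>pi_r\<close> sorts probabilities, while merging acts on labels. Sorting the
  labels by \<open>\<pi>\<close> gives the same list of probabilities, and \<open>S\<close> consists
  of the first \<open>d - r + 1\<close> labels in decreasing order; ties may fall either way without
  changing the entropy.\<close>

lemma ent_pi_r:
  assumes "r \<in> {1..d-1}"
  obtains S where "S \<subseteq> {1..d}" "card S = d - r + 1"
    "ent (pi_r d \<pi> r) = - ((\<Sum>t\<in>S. \<pi> t) * ln (\<Sum>t\<in>S. \<pi> t) + (\<Sum>t\<in>{1..d} - S. \<pi> t * ln (\<pi> t)))"
proof -
  define Ts where "Ts = rev (sort_key \<pi> [1..<d+1])"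
  define k where "k = d - r + 1"
  define S where "S = set (take k Ts)"
  have "sort (map \<pi> [1..<d+1]) = map \<pi> (sort_key \<pi> [1..<d+1])"
    by (rule properties_for_sort) (simp_all del: upt_Suc)
  hence L: "rev (sort (pvec d \<pi>)) = map \<pi> Ts"
    by (simp add: Ts_def pvec_def rev_map del: upt_Suc)
  have dist: "distinct Ts" by (simp add: Ts_def)
  have setT: "set Ts = {1..d}" by (auto simp: Ts_def)
  have lenT: "length Ts = d" by (simp add: Ts_def)
  have D: "set (drop k Ts) = {1..d} - S"
  proof -
    have "set Ts = S \<union> set (drop k Ts)" "S \<inter> set (drop k Ts) = {}"
      unfolding S_def using dist
      by (metis append_take_drop_id set_append, metis append_take_drop_id distinct_append)
    thus ?thesis using setT by blast
  qed
  have "(\<Sum>t\<leftarrow>take k Ts. \<pi> t) = (\<Sum>t\<in>S. \<pi> t)"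
    unfolding S_def using dist by (intro sum_list_distinct_conv_sum_set) simp
  moreover have "(\<Sum>t\<leftarrow>drop k Ts. \<pi> t * ln (\<pi> t)) = (\<Sum>t\<in>{1..d} - S. \<pi> t * ln (\<pi> t))"
    unfolding D[symmetric] using dist by (intro sum_list_distinct_conv_sum_set) simp
  ultimately have "ent (pi_r d \<pi> r) = - ((\<Sum>t\<in>S. \<pi> t) * ln (\<Sum>t\<in>S. \<pi> t) + (\<Sum>t\<in>{1..d} - S. \<pi> t * ln (\<pi> t)))"
    by (simp add: ent_def pi_r_def Let_def L take_map drop_map o_def k_def)
  moreover have "S \<subseteq> {1..d}" using setT set_take_subset by (fastforce simp: S_def)
  moreover have "card S = d - r + 1"
    unfolding S_def using dist lenT assms by (subst distinct_card) (auto simp: k_def)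
  ultimately show ?thesis using that by blast
qed

section \<open>From counting to the error probability\<close>

text \<open>A success is either typical, and counted through merged vectors, or has one of its
  \<open>n * d\<close> counts deviating by at least \<open>s\<close>, which a union bound controls.
  Both parts are expressed as fractions of \<open>Bset\<close>, so the factor in front of its
  cardinality bounds the success probability for a fixed matrix and decoder.\<close>

lemma card_success_le:
  fixes l s :: real
  assumes pi: "\<forall>t\<in>{1..d}. \<pi> t \<ge> 0" "(\<Sum>t\<in>{1..d}. \<pi> t) = 1"
    and int: "\<forall>t\<in>{1..d}. real p * \<pi> t \<in> \<int>" and r: "r \<in> {1..d-1}"
    and l: "0 \<le> l" "l \<le> 1" and s: "s \<ge> 0"
  shows "real (card {b \<in> Bset d \<pi> p. card {j\<in>{0..<p}. c (outcome n p X b) j \<noteq> b j} \<le> q})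
    \<le> (exp 1 * (real p + 1)) ^ d *
       (exp (real p * ent (pi_r d \<pi> r) - real p * ent (pvec d \<pi>)) * (2 * s + 1) ^ (n * (d - r))
           * (\<Sum>j\<le>q. real (p choose j) * (real d - 1) ^ j)
         + real n * real d * (2 * exp (real p * l\<^sup>2 - l * s)))
       * real (card (Bset d \<pi> p))"
    (is "real (card ?G) \<le> ?P * (?H * ?M * ?ball + ?n * ?E) * ?B")
proof -
  obtain S where S: "S \<subseteq> {1..d}" "card S = d - r + 1" and
    ent: "ent (pi_r d \<pi> r) = - ((\<Sum>t\<in>S. \<pi> t) * ln (\<Sum>t\<in>S. \<pi> t) + (\<Sum>t\<in>{1..d} - S. \<pi> t * ln (\<pi> t)))"
    using ent_pi_r[OF r] .
  define dev where "dev i t b \<longleftrightarrow> \<bar>real (Ncount p b (X i) t) - real (card {j\<in>{0..<p}. X i j}) * \<pi> t\<bar> \<ge> s" for i t b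
  define G1 where "G1 = {b \<in> Bset d \<pi> p. (\<forall>i<n. \<forall>t\<in>{1..d}.
      \<bar>real (Ncount p b (X i) t) - real (card {j\<in>{0..<p}. X i j}) * \<pi> t\<bar> < s) \<and>
      card {j\<in>{0..<p}. c (outcome n p X b) j \<noteq> b j} \<le> q}"
  define G2 where "G2 = (\<Union>it\<in>{0..<n} \<times> {1..d}. {b \<in> Bset d \<pi> p. dev (fst it) (snd it) b})"
  have fin: "finite G1" "finite G2"
    unfolding G1_def G2_def by (auto intro!: finite_Bset finite_SigmaI)
  have d: "d \<ge> 1" using r by auto
  have ball: "real (\<Sum>i\<le>q. (p choose i) * (d - 1) ^ i) = ?ball"
    using d by (simp add: of_nat_diff)
  have ball0: "?ball \<ge> 0" unfolding ball[symmetric] by (rule of_nat_0_le_iff)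
  have "?G \<subseteq> G1 \<union> G2"
  proof
    fix b assume b: "b \<in> ?G"
    show "b \<in> G1 \<union> G2"
    proof (cases "\<exists>i<n. \<exists>t\<in>{1..d}. dev i t b")
      case True
      then obtain i t where "i < n" "t \<in> {1..d}" "dev i t b" by blast
      hence "b \<in> G2" unfolding G2_def using b by (intro UN_I[of "(i, t)"]) auto
      thus ?thesis by blast
    next
      case False
      hence "\<forall>i<n. \<forall>t\<in>{1..d}. \<not> dev i t b" by blast
      hence "b \<in> G1" using b unfolding G1_def dev_def not_le mem_Collect_eq by (intro conjI) simp_all
      thus ?thesis by blast
    qed
  qed
  hence "card ?G \<le> card (G1 \<union> G2)" using fin by (intro card_mono) auto
  also have "\<dots> \<le> card G1 + card G2" by (rule card_Un_le)
  finally have "real (card ?G) \<le> real (card G1) + real (card G2)" by linarith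
  moreover have "real (card G2) \<le> ?n * (?B * ?P * ?E)"
  proof -
    have "real (card G2) \<le> (\<Sum>it\<in>{0..<n} \<times> {1..d}. real (card {b \<in> Bset d \<pi> p. dev (fst it) (snd it) b}))"
      unfolding G2_def of_nat_sum[symmetric] of_nat_le_iff by (intro card_UN_le) auto
    also have "\<dots> \<le> (\<Sum>it\<in>{0..<n} \<times> {1..d}. ?B * ?P * ?E)"
      unfolding dev_def
      by (intro sum_mono card_Bset_deviation_le) (use pi int l in auto)
    finally show ?thesis by (simp add: card_cartesian_product)
  qed
  moreover have "real (card G1) \<le> exp (real p * ent (pi_r d \<pi> r)) * ?M * ?ball"
  proof -
    have "real (card G1) \<le> real (card (merge_labels S p ` Bset d \<pi> p)) * (2 * s + 1) ^ (n * (card S - 1))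
            * real (\<Sum>i\<le>q. (p choose i) * (d - 1) ^ i)"
      unfolding G1_def by (rule card_typical_success_le) (use S s in auto)
    also have "\<dots> \<le> exp (real p * ent (pi_r d \<pi> r)) * (2 * s + 1) ^ (n * (card S - 1))
            * real (\<Sum>i\<le>q. (p choose i) * (d - 1) ^ i)"
    proof (intro mult_right_mono of_nat_0_le_iff)
      show "real (card (merge_labels S p ` Bset d \<pi> p)) \<le> exp (real p * ent (pi_r d \<pi> r))"
        using card_merged_Bset_le[OF pi S(1), of p] unfolding ent mult_minus_left mult_minus_right .
    qed (use s in simp)
    finally show ?thesis unfolding ball using S(2) by simp
  qed
  moreover have "exp (real p * ent (pi_r d \<pi> r)) * ?M * ?ball \<le> ?P * (?H * ?M * ?ball) * ?B"
  proof -
    \<comment> \<open>The factor \<open>exp (p * H(\<pi>))\<close> is split off and traded for the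
      size of \<open>Bset\<close> times the polynomial factor.\<close>
    have "exp (real p * ent (pi_r d \<pi> r)) = ?H * exp (real p * ent (pvec d \<pi>))"
      by (simp flip: exp_add)
    also have "\<dots> \<le> ?H * (?B * ?P)"
      using card_Bset_ge[OF pi int] by (intro mult_left_mono) (auto simp: ent_pvec)
    finally have "exp (real p * ent (pi_r d \<pi> r)) * (?M * ?ball) \<le> ?H * (?B * ?P) * (?M * ?ball)"
      using s ball0 by (intro mult_right_mono) auto
    moreover have "x * (B * P) * (M * b) = P * (x * M * b) * B" for x B P M b :: real
      by (simp add: mult_ac)
    ultimately show ?thesis by (simp only: mult.assoc)
  qed
  ultimately have "real (card ?G) \<le> ?P * (?H * ?M * ?ball) * ?B + ?n * (?B * ?P * ?E)"
    by linarith
  moreover have "P * x * B + m * (B * P * y) = P * (x + m * y) * B" for P x B m y :: real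
    by (simp add: algebra_simps)
  ultimately show ?thesis by (simp only:)
qed

text \<open>Matrix and decoder are drawn independently of the label vector, so a bound on the
  success probability that holds for each fixed pair survives averaging over
  \<open>D\<close>.\<close>

lemma Perr_ge:
  assumes B: "Bset d \<pi> p \<noteq> {}" and C: "C \<ge> 0"
    and le: "\<And>X dec. real (card {b \<in> Bset d \<pi> p. card {j\<in>{0..<p}. dec X (outcome n p X b) j \<noteq> b j} \<le> q})
                \<le> C * real (card (Bset d \<pi> p))"
  shows "Perr d \<pi> p n q D \<ge> 1 - C"
proof -
  let ?A = "pmf_of_set (Bset d \<pi> p)"
  define E where "E = {(b, (X, dec)). card {j\<in>{0..<p}. (dec :: decoder) X (outcome n p X b) j \<noteq> b j} > q}"
  have pos: "card (Bset d \<pi> p) > 0" using B finite_Bset by (simp add: card_gt_0_iff)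
  \<comment> \<open>Swapping the pair makes the integral over \<open>D\<close> the outer one, which
    amounts to conditioning on matrix and decoder.\<close>
  have "emeasure (pair_pmf ?A D) (- E) = emeasure (pair_pmf D ?A) ((\<lambda>(x, y). (y, x)) -` (- E))"
    by (subst pair_commute_pmf) simp
  also have "\<dots> = (\<integral>\<^sup>+z. indicator ((\<lambda>(x, y). (y, x)) -` (- E)) z \<partial>pair_pmf D ?A)"
    by simp
  also have "\<dots> = (\<integral>\<^sup>+y. \<integral>\<^sup>+b. indicator {b. (b, y) \<notin> E} b \<partial>?A \<partial>D)"
    by (subst nn_integral_pair_pmf') (intro nn_integral_cong, auto simp: indicator_def)
  also have "\<dots> = (\<integral>\<^sup>+y. emeasure ?A {b. (b, y) \<notin> E} \<partial>D)"
    by simp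
  also have "\<dots> \<le> (\<integral>\<^sup>+y. ennreal C \<partial>D)"
  proof (intro nn_integral_mono)
    fix y :: "test_matrix \<times> decoder"
    obtain X dec where y: "y = (X, dec)" by force
    have "measure ?A {b. (b, y) \<notin> E}
        = real (card {b \<in> Bset d \<pi> p. card {j\<in>{0..<p}. dec X (outcome n p X b) j \<noteq> b j} \<le> q}) / real (card (Bset d \<pi> p))"
      using B finite_Bset by (simp add: measure_pmf_of_set y E_def Int_def not_less)
    also have "\<dots> \<le> C" using le pos by (simp add: divide_le_eq)
    finally show "emeasure ?A {b. (b, y) \<notin> E} \<le> ennreal C"
      by (simp add: measure_pmf.emeasure_eq_measure ennreal_leI)
  qed
  also have "\<dots> = ennreal C" by simp
  finally have "measure (pair_pmf ?A D) (- E) \<le> C"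
    using C by (simp add: measure_pmf.emeasure_eq_measure)
  moreover have "measure (pair_pmf ?A D) (- E) = 1 - measure (pair_pmf ?A D) E"
    using measure_pmf.prob_compl[of E "pair_pmf ?A D"] by (simp add: Compl_eq_Diff_UNIV)
  ultimately show ?thesis by (simp add: Perr_def E_def)
qed

text \<open>The bound on successes is applied at the maximising \<open>r\<close>. Of the two
  subtracted terms, the first comes from typical successes, where the slack \<open>\<eta>\<close>
  beats the polynomial factor, and the second from deviating counts.\<close>

lemma Perr_ge_explicit:
  fixes \<eta> :: real and \<pi> :: "nat \<Rightarrow> real" and d :: nat
  defines "H \<equiv> ent (pvec d \<pi>)"
  assumes d: "d \<ge> 2"
    and pi: "\<forall>t\<in>{1..d}. \<pi> t \<ge> 0" "(\<Sum>t\<in>{1..d}. \<pi> t) = 1"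
    and int: "\<forall>t\<in>{1..d}. real p * \<pi> t \<in> \<int>"
    and \<eta>: "0 < \<eta>" "\<eta> < 1"
    and n: "real n < nbound d \<pi> p q * (1 - \<eta>)"
    and large: "nbound d \<pi> p q * \<eta>\<^sup>2 \<ge> 4 * real d"
    and p: "ln (real p) \<ge> 1" "ln (real p) \<le> 2 * sqrt (real p)"
      "ln (2 * (sqrt (real p) * ln (real p)) + 1) \<le> (1 + \<eta>) / 2 * ln (real p)"
  shows "Perr d \<pi> p n q D \<ge> 1 - (exp (real d * (1 + ln (real p + 1) - 2 * ln (real p)))
           + (exp 1 * (real p + 1)) ^ d * (2 * real p * H * real d * (2 * exp (- (ln (real p))\<^sup>2 / 4))))"
proof -
  define N where "N = nbound d \<pi> p q"
  define L where "L = ln (real p)"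
  define ball where "ball = (\<Sum>j\<le>q. real (p choose j) * (real d - 1) ^ j)"
  \<comment> \<open>The choice \<open>l = s / (2 * p)\<close> minimises
    \<open>p * l\<^sup>2 - l * s\<close>. With this \<open>s\<close> the minimum is
    \<open>- L\<^sup>2 / 4\<close>, small enough to beat any power of \<open>p\<close>, while
    \<open>ln (2 * s + 1)\<close> is still only about \<open>L / 2\<close>.\<close>
  define s where "s = sqrt (real p) * L"
  define l where "l = L / (2 * sqrt (real p))"
  define P where "P = (exp 1 * (real p + 1)) ^ d"
  have L: "L \<ge> 1" using p by (simp add: L_def)
  have p0: "real p > 0" using L by (cases "p = 0") (auto simp: L_def)
  have N0: "N > 0"
  proof (rule ccontr)
    assume "\<not> N > 0"
    hence "N * \<eta>\<^sup>2 \<le> 0" by (simp add: mult_nonpos_nonneg)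
    thus False using large d by (simp add: N_def)
  qed
  obtain r where r: "r \<in> {1..d-1}" and Nr: "N = 1 / L * (2 * (real p * H - real p * ent (pi_r d \<pi> r) - ln ball) / real (d - r))"
  proof -
    let ?f = "\<lambda>r. 2 * (real p * H - real p * ent (pi_r d \<pi> r) - ln ball) / real (d - r)"
    have "Max (?f ` {1..d-1}) \<in> ?f ` {1..d-1}" using d by (intro Max_in) auto
    then obtain r where "r \<in> {1..d-1}" "Max (?f ` {1..d-1}) = ?f r" by blast
    thus ?thesis using that by (simp add: N_def nbound_def L_def H_def ball_def)
  qed
  define R where "R = real (d - r)"
  have R: "R \<ge> 1" using r d by (auto simp: R_def)
  \<comment> \<open>The definition of \<open>nbound\<close> at its maximiser, solved for the
    exponent that governs the typical successes.\<close>
  have key: "real p * ent (pi_r d \<pi> r) - real p * H + ln ball = - (N * L * R / 2)"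
    using Nr L R by (simp add: R_def[symmetric] field_simps)
  have ball: "ball \<ge> 1"
  proof -
    have "(\<Sum>j\<in>{0}. real (p choose j) * (real d - 1) ^ j) \<le> ball"
      unfolding ball_def using d by (intro sum_mono2) auto
    thus ?thesis by simp
  qed
  have B: "Bset d \<pi> p \<noteq> {}"
  proof
    assume "Bset d \<pi> p = {}"
    with card_Bset_ge[OF pi int] show False by simp
  qed
  \<comment> \<open>Nonnegativity is read off from counting: the merged set has at least one element
    and at most \<open>exp\<close> of this quantity.\<close>
  have Hr: "real p * ent (pi_r d \<pi> r) \<ge> 0"
  proof -
    obtain S where S: "S \<subseteq> {1..d}" and
      ent: "ent (pi_r d \<pi> r) = - ((\<Sum>t\<in>S. \<pi> t) * ln (\<Sum>t\<in>S. \<pi> t) + (\<Sum>t\<in>{1..d} - S. \<pi> t * ln (\<pi> t)))"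
      using ent_pi_r[OF r] by metis
    have "card (merge_labels S p ` Bset d \<pi> p) \<ge> 1"
      using B finite_Bset by (simp add: Suc_le_eq card_gt_0_iff)
    hence "1 \<le> exp (real p * ent (pi_r d \<pi> r))"
      using card_merged_Bset_le[OF pi S, of p] unfolding ent mult_minus_left mult_minus_right by linarith
    thus ?thesis by simp
  qed
  \<comment> \<open>The union bound over tests has a factor \<open>n\<close>; this crude linear
    bound makes it harmless.\<close>
  have nN: "real n \<le> 2 * real p * H"
  proof -
    have "N * \<eta> \<ge> 0" using N0 \<eta> by simp
    hence "real n \<le> N" using n by (simp add: N_def[symmetric] algebra_simps)
    also have "N \<le> N * L * R"
      using mult_mono[of 1 L 1 R] mult_left_mono[of 1 "L * R" N] N0 L R by (simp add: mult.assoc)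
    also have "\<dots> \<le> 2 * real p * H"
      using key Hr ln_ge_zero[OF ball] by linarith
    finally show ?thesis .
  qed
  have l: "0 \<le> l" "l \<le> 1"
    using p p0 L by (auto simp: l_def L_def)
  have s: "s \<ge> 0" using L by (simp add: s_def)
  have ex: "real p * l\<^sup>2 - l * s = - L\<^sup>2 / 4"
    using p0 by (simp add: l_def s_def power2_eq_square field_simps)
  have P0: "P > 0" unfolding P_def by (intro zero_less_power mult_pos_pos) auto
  have "exp (real p * ent (pi_r d \<pi> r) - real p * H) * (2 * s + 1) ^ (n * (d - r)) * ball * P
      = exp (real d * (1 + ln (real p + 1)) - N * L * R / 2 + R * (real n * ln (2 * s + 1)))"
  proof -
    have e1: "(2 * s + 1) ^ (n * (d - r)) = exp (R * (real n * ln (2 * s + 1)))"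
      using s by (simp add: R_def mult_ac exp_of_nat_mult flip: of_nat_mult mult.assoc)
    have e2: "P = exp (real d * (1 + ln (real p + 1)))"
      unfolding P_def exp_of_nat_mult by (simp add: exp_add)
    have e3: "exp (real p * ent (pi_r d \<pi> r) - real p * H) * ball = exp (- (N * L * R / 2))"
      using ball by (simp add: exp_add flip: key)
    have "exp (real p * ent (pi_r d \<pi> r) - real p * H) * (2 * s + 1) ^ (n * (d - r)) * ball * P
        = (exp (real p * ent (pi_r d \<pi> r) - real p * H) * ball) * ((2 * s + 1) ^ (n * (d - r)) * P)"
      by (simp only: mult_ac)
    thus ?thesis unfolding e1 e2 e3 by (simp flip: exp_add)
  qed
  also have "\<dots> \<le> exp (real d * (1 + ln (real p + 1) - 2 * L))"
  proof -
    \<comment> \<open>Since \<open>(1 - \<eta>) * (1 + \<eta>) = 1 - \<eta>\<^sup>2\<close>, the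
      slack in \<open>n\<close> outweighs the excess of the window size over \<open>sqrt p\<close>.
      What is left, \<open>N * \<eta>\<^sup>2 * L / 2\<close>, is at least \<open>2 * d * L\<close>
      and absorbs the polynomial factor \<open>P\<close>.\<close>
    have "ln (2 * s + 1) \<le> (1 + \<eta>) / 2 * L" using p by (simp add: s_def L_def)
    hence "real n * ln (2 * s + 1) \<le> N * (1 - \<eta>) * ((1 + \<eta>) / 2 * L)"
      using n s N0 \<eta> by (intro mult_mono) (auto simp: N_def)
    also have "\<dots> = N * L / 2 - N * \<eta>\<^sup>2 * L / 2"
      by (simp add: power2_eq_square field_simps)
    finally have "R * (real n * ln (2 * s + 1)) \<le> R * (N * L / 2 - N * \<eta>\<^sup>2 * L / 2)"
      using R by (intro mult_left_mono) auto
    moreover have "N * \<eta>\<^sup>2 * L / 2 \<ge> 4 * real d * L / 2"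
      using mult_right_mono[OF large, of L] L by (simp add: N_def)
    moreover have "R * (N * \<eta>\<^sup>2 * L / 2) \<ge> 1 * (N * \<eta>\<^sup>2 * L / 2)"
      using R L N0 by (intro mult_right_mono) auto
    ultimately show ?thesis by (simp add: algebra_simps)
  qed
  finally have t1: "P * (exp (real p * ent (pi_r d \<pi> r) - real p * H) * (2 * s + 1) ^ (n * (d - r)) * ball)
      \<le> exp (real d * (1 + ln (real p + 1) - 2 * L))" by (simp add: mult_ac)
  have t2: "P * (real n * real d * (2 * exp (real p * l\<^sup>2 - l * s)))
      \<le> P * (2 * real p * H * real d * (2 * exp (- L\<^sup>2 / 4)))"
    unfolding ex using nN P0 by (intro mult_left_mono mult_right_mono) auto
  let ?C = "P * (exp (real p * ent (pi_r d \<pi> r) - real p * H) * (2 * s + 1) ^ (n * (d - r)) * ball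
         + real n * real d * (2 * exp (real p * l\<^sup>2 - l * s)))"
  have "Perr d \<pi> p n q D \<ge> 1 - ?C"
  proof (rule Perr_ge[OF B])
    show "?C \<ge> 0" using P0 s ball by simp
    show "real (card {b \<in> Bset d \<pi> p. card {j\<in>{0..<p}. dec X (outcome n p X b) j \<noteq> b j} \<le> q})
        \<le> ?C * real (card (Bset d \<pi> p))" for X dec
      unfolding P_def H_def ball_def by (rule card_success_le[OF pi int r l s])
  qed
  thus ?thesis using t1 t2 unfolding L_def[symmetric] P_def[symmetric] distrib_left[of P]
    by linarith
qed

section \<open>Asymptotics\<close>

text \<open>The first term is of order \<open>x\<close> to the power \<open>- d\<close>; in the
  second, \<open>exp (- (ln x)\<^sup>2 / 4)\<close> decays faster than any power of
  \<open>x\<close>.\<close>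

lemma error_terms_tendsto_0:
  fixes H :: real and d :: nat
  assumes "d \<ge> 1"
  shows "((\<lambda>x::real. exp (real d * (1 + ln (x + 1) - 2 * ln x))
           + (exp 1 * (x + 1)) ^ d * (2 * x * H * real d * (2 * exp (- (ln x)\<^sup>2 / 4)))) \<longlongrightarrow> 0) at_top"
proof -
  have lim1: "((\<lambda>x::real. exp (real d * (1 + ln (x + 1) - 2 * ln x))) \<longlongrightarrow> 0) at_top"
  proof -
    have "filterlim (\<lambda>x::real. 1 + ln (x + 1) - 2 * ln x) at_bot at_top" by real_asymp
    hence "filterlim (\<lambda>x::real. real d * (1 + ln (x + 1) - 2 * ln x)) at_bot at_top"
      using assms by (subst filterlim_tendsto_pos_mult_at_bot_iff[OF tendsto_const]) auto
    thus ?thesis by (rule filterlim_compose[OF exp_at_bot])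
  qed
  have lim2: "((\<lambda>x::real. (exp 1 * (x + 1)) ^ d * (2 * x * H * real d * (2 * exp (- (ln x)\<^sup>2 / 4)))) \<longlongrightarrow> 0) at_top"
  proof -
    \<comment> \<open>The power with symbolic exponent \<open>d\<close> is written as an
      exponential, and the constant \<open>4 * H * d\<close> is left aside until the limit is
      known.\<close>
    have "((\<lambda>x::real. exp (real d * (1 + ln (x + 1))) * (x * exp (- (ln x)\<^sup>2 / 4))) \<longlongrightarrow> 0) at_top"
      using assms by real_asymp
    hence "((\<lambda>x::real. (4 * H * real d) * (exp (real d * (1 + ln (x + 1))) * (x * exp (- (ln x)\<^sup>2 / 4)))) \<longlongrightarrow> (4 * H * real d) * 0) at_top"
      by (intro tendsto_mult tendsto_const)
    hence *: "((\<lambda>x::real. (4 * H * real d) * (exp (real d * (1 + ln (x + 1))) * (x * exp (- (ln x)\<^sup>2 / 4)))) \<longlongrightarrow> 0) at_top"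
      by simp
    show ?thesis
    proof (rule Lim_transform_eventually[OF *])
      show "\<forall>\<^sub>F x in at_top. (4 * H * real d) * (exp (real d * (1 + ln (x + 1))) * (x * exp (- (ln x)\<^sup>2 / 4)))
          = (exp 1 * (x + 1)) ^ d * (2 * x * H * real d * (2 * exp (- (ln x)\<^sup>2 / 4)))"
        using eventually_gt_at_top[of 0]
        by eventually_elim (simp add: exp_of_nat_mult exp_add)
    qed
  qed
  show ?thesis using tendsto_add[OF lim1 lim2] by (simp only: add_0_left)
qed

text \<open>Necessity is expressed by its contrapositive, along a sequence of problem sizes
  \<open>p k\<close> because \<open>p * \<pi> t\<close> is integral only for suitable
  \<open>p\<close>. Divergence of \<open>nbound\<close> makes \<open>nbound * \<eta>\<^sup>2\<close>
  eventually exceed \<open>4 * d\<close>, whatever \<open>\<eta>\<close> is.\<close>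

theorem theorem3:
  fixes d :: nat and \<pi> :: "nat \<Rightarrow> real" and \<eta> :: real
    and p n qmax :: "nat \<Rightarrow> nat" and D :: "nat \<Rightarrow> (test_matrix \<times> decoder) pmf"
  assumes "d \<ge> 2"
    and "\<forall>t\<in>{1..d}. \<pi> t \<ge> 0" and "(\<Sum>t\<in>{1..d}. \<pi> t) = 1"
    and "\<forall>k. \<forall>t\<in>{1..d}. real (p k) * \<pi> t \<in> \<int>"
    and "filterlim p at_top sequentially"
    and "\<forall>k. qmax k \<le> p k"
    and "\<eta> > 0"
    and "filterlim (\<lambda>k. nbound d \<pi> (p k) (qmax k)) at_top sequentially"
    and "eventually (\<lambda>k. real (n k) < nbound d \<pi> (p k) (qmax k) * (1 - \<eta>)) sequentially"
  shows "(\<lambda>k. Perr d \<pi> (p k) (n k) (qmax k) (D k)) \<longlonglongrightarrow> 1"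
proof -
  define H where "H = ent (pvec d \<pi>)"
  define e where "e x = exp (real d * (1 + ln (x + 1) - 2 * ln x))
      + (exp 1 * (x + 1)) ^ d * (2 * x * H * real d * (2 * exp (- (ln x)\<^sup>2 / 4)))" for x :: real
  have lim: "filterlim (\<lambda>k. real (p k)) at_top sequentially"
    using assms(5) by (rule filterlim_compose[OF filterlim_real_sequentially])
  have Npos: "\<forall>\<^sub>F k in sequentially. nbound d \<pi> (p k) (qmax k) > 0"
    using assms(8) by (simp add: filterlim_at_top_dense)
  \<comment> \<open>Otherwise \<open>n k\<close> would have to lie below a nonpositive number once
    \<open>nbound\<close> is positive.\<close>
  have "\<eta> < 1"
  proof -
    have "\<forall>\<^sub>F k in sequentially. \<eta> < 1"
      using Npos assms(9)
    proof eventually_elim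
      case (elim k)
      hence "nbound d \<pi> (p k) (qmax k) * (1 - \<eta>) > 0"
        by (meson le_less_trans of_nat_0_le_iff)
      thus ?case using elim(1) by (simp add: zero_less_mult_iff)
    qed
    thus ?thesis by simp
  qed
  have large: "\<forall>\<^sub>F k in sequentially. nbound d \<pi> (p k) (qmax k) * \<eta>\<^sup>2 \<ge> 4 * real d"
  proof -
    have "\<forall>\<^sub>F k in sequentially. nbound d \<pi> (p k) (qmax k) \<ge> 4 * real d / \<eta>\<^sup>2"
      using assms(8) by (simp add: filterlim_at_top)
    thus ?thesis by eventually_elim (use assms(7) in \<open>simp add: divide_le_eq\<close>)
  qed
  have "\<forall>\<^sub>F x::real in at_top. ln x \<ge> 1" by real_asymp
  moreover have "\<forall>\<^sub>F x::real in at_top. ln x \<le> 2 * sqrt x" by real_asymp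
  moreover have "\<forall>\<^sub>F x::real in at_top. ln (2 * (sqrt x * ln x) + 1) \<le> (1 + \<eta>) / 2 * ln x"
  proof -
    \<comment> \<open>The limit \<open>1 / 2\<close> reflects the square root in the window size;
      any positive \<open>\<eta>\<close> leaves room above it for the logarithmic factor.\<close>
    have "((\<lambda>x::real. ln (2 * (sqrt x * ln x) + 1) / ln x) \<longlongrightarrow> 1 / 2) at_top" by real_asymp
    hence "\<forall>\<^sub>F x::real in at_top. ln (2 * (sqrt x * ln x) + 1) / ln x < (1 + \<eta>) / 2"
      using assms(7) by (intro order_tendstoD(2)) auto
    thus ?thesis using eventually_gt_at_top[of 1]
      by eventually_elim (simp add: divide_less_eq)
  qed
  ultimately have "\<forall>\<^sub>F x::real in at_top. ln x \<ge> 1 \<and> ln x \<le> 2 * sqrt x \<and>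
      ln (2 * (sqrt x * ln x) + 1) \<le> (1 + \<eta>) / 2 * ln x"
    by eventually_elim blast
  hence "\<forall>\<^sub>F k in sequentially. ln (real (p k)) \<ge> 1 \<and> ln (real (p k)) \<le> 2 * sqrt (real (p k)) \<and>
      ln (2 * (sqrt (real (p k)) * ln (real (p k))) + 1) \<le> (1 + \<eta>) / 2 * ln (real (p k))"
    by (rule eventually_compose_filterlim[OF _ lim])
  hence lower: "\<forall>\<^sub>F k in sequentially. 1 - e (real (p k)) \<le> Perr d \<pi> (p k) (n k) (qmax k) (D k)"
    using large assms(9)
  proof eventually_elim
    case (elim k)
    thus ?case unfolding e_def H_def
      using assms(1-4,7) \<open>\<eta> < 1\<close> by (intro Perr_ge_explicit[where \<eta> = \<eta>]) auto
  qed
  have upper: "\<forall>\<^sub>F k in sequentially. Perr d \<pi> (p k) (n k) (qmax k) (D k) \<le> 1"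
    by (simp add: Perr_def)
  have "(\<lambda>k. e (real (p k))) \<longlonglongrightarrow> 0"
    unfolding e_def using assms(1) by (intro filterlim_compose[OF error_terms_tendsto_0 lim]) auto
  hence "(\<lambda>k. 1 - e (real (p k))) \<longlonglongrightarrow> 1 - 0"
    by (intro tendsto_diff tendsto_const)
  thus ?thesis
    using tendsto_sandwich[OF lower upper _ tendsto_const] by simp
qed

end
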